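(* Let $t,m\in\mathbb{N}$, let $P:\mathbb{Z}^t\to\mathbb{Z}^m$ be a polynomial mapping satisfying $P(0)=0$, let $F\subset\mathbb{Z}^t$ be a finite set and let $\chi:\mathbb{Z}^m\to\{1,\dots,r\}$ be a finite coloring. Then there is $l$, $1\le l\le r$, such that the set $$\{(n_1,\dots,n_t)\in\mathbb{Z}^t:\ \text{there is } a\in\mathbb{Z}^m \text{ such that } \chi(a+P(n_1v_1,\dots,n_tv_t))=l \text{ for all } (v_1,\dots,v_t)\in F\}$$ is an IP$^*$-subset of $\mathbb{Z}^t$.
   Context: A polynomial mapping $P:\mathbb{Z}^t\to\mathbb{Z}^m$ is a map each of whose coordinate functions is a polynomial in $t$ variables (with rational coefficients) taking integer values on $\mathbb{Z}^t$. For a commutative semigroup $(G,+)$ and a sequence $(u_i)_{i\in\mathbb{N}}$ in $G$, the IP-set generated by $(u_i)$ is $\{\sum_{i\in\alpha}u_i:\ \alpha\subset\mathbb{N},\ 0<|\alpha|<\infty\}$. A subset of $G$ is an IP$^*$-set if it has nonempty intersection with every IP-set in $G$. *)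

theory Defs
  imports "HOL-Analysis.Finite_Cartesian_Product"
begin

text \<open>A polynomial in the variables indexed by \<open>'t\<close> is given by a finite set \<open>A\<close> of exponent
  vectors and rational coefficients \<open>c\<close>. Integrality of the values is built into the codomain of
  the mapping; the coefficients need not be integers.\<close>

definition rat_polynomial :: "(rat ^ 't \<Rightarrow> rat) \<Rightarrow> bool" where
  "rat_polynomial q \<longleftrightarrow>
    (\<exists>(A :: ('t \<Rightarrow> nat) set) c. finite A \<and>
      (\<forall>x. q x = (\<Sum>\<alpha>\<in>A. c \<alpha> * (\<Prod>i\<in>UNIV. (x $ i) ^ \<alpha> i))))"

definition polynomial_mapping :: "(int ^ 't \<Rightarrow> int ^ 'm) \<Rightarrow> bool" where
  "polynomial_mapping P \<longleftrightarrow>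
    (\<forall>j. \<exists>q. rat_polynomial q \<and> (\<forall>n. of_int (P n $ j) = q (\<chi> i. of_int (n $ i))))"

definition IP_set_gen :: "(nat \<Rightarrow> 'a :: comm_monoid_add) \<Rightarrow> 'a set" where
  "IP_set_gen u = {\<Sum>i\<in>\<alpha>. u i | \<alpha>. finite \<alpha> \<and> \<alpha> \<noteq> {}}"

definition IP_star_set :: "'a :: comm_monoid_add set \<Rightarrow> bool" where
  "IP_star_set S \<longleftrightarrow> (\<forall>u. S \<inter> IP_set_gen u \<noteq> {})"

end

theory Submission
  imports Defs "HOL-Library.Multiset" "HOL-Library.FuncSet"
begin

text \<open>Fixing IP-sets generated by \<open>u 1, \<dots>, u r\<close>, each \<open>\<alpha> \<mapsto> P((\<Sum>k\<in>\<alpha>. u l k) \<cdot> v)\<close> is a set-polynomial: a sum of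
  coefficients \<open>c \<beta>\<close> over \<open>\<beta> \<subseteq> \<alpha>\<close> that vanish when \<open>\<beta>\<close> is large. A van der Waerden theorem
  for finitely many set-polynomials is applied to all \<open>l \<in> {1..r}\<close> and \<open>v \<in> F\<close> at once; the colour \<open>l\<close>
  of the resulting monochromatic configuration yields an element of the \<open>l\<close>-th IP-set. Hence it cannot
  happen that for every \<open>l\<close> the set belonging to \<open>l\<close> misses the IP-set generated by \<open>u l\<close>.

  The van der Waerden theorem is proved by colour focusing and PET induction: focusing reduces a
  family \<open>A\<close> to the family of all \<open>c\<^sup>\<gamma> - c1\<close>, where \<open>c\<^sup>\<gamma>(\<alpha>) = c(\<gamma> \<union> \<alpha>) - c(\<gamma>)\<close> and \<open>c1 \<in> A\<close> has
  minimal degree, which replaces one class of leading terms by finitely many of smaller degree.\<close>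

section \<open>Set-polynomials, their degrees and the van der Waerden property\<close>

text \<open>Omitting the empty support forces the value 0 at the empty set, in accordance with P(0)
  = 0.\<close>

definition set_poly :: "(nat set \<Rightarrow> 'g::ab_group_add) \<Rightarrow> nat set \<Rightarrow> 'g" where
  "set_poly c \<alpha> = (\<Sum>\<beta>\<in>Pow \<alpha> - {{}}. c \<beta>)"

text \<open>The coefficients of the increment \<open>c\<^sup>\<gamma>\<close>, meant for \<beta>
  disjoint from \<gamma>: whatever is supported on \<beta> together with some part of \<gamma> is
  collected at \<beta>.\<close>

definition shift :: "nat set \<Rightarrow> (nat set \<Rightarrow> 'g::ab_group_add) \<Rightarrow> nat set \<Rightarrow> 'g" where
  "shift \<gamma> c \<beta> = (\<Sum>\<epsilon>\<in>Pow \<gamma>. c (\<epsilon> \<union> \<beta>))"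

text \<open>Degree below \<open>d\<close>, tested only on supports beyond \<open>N\<close>: each
  focusing step continues with fresh indices, so coefficients that touch earlier ones can be
  disregarded.\<close>

definition vanishing :: "nat \<Rightarrow> nat \<Rightarrow> (nat set \<Rightarrow> 'g::ab_group_add) \<Rightarrow> bool" where
  "vanishing N d c \<longleftrightarrow>
    (\<forall>\<beta>. finite \<beta> \<and> \<beta> \<noteq> {} \<and> \<beta> \<subseteq> {N..} \<and> d \<le> card \<beta> \<longrightarrow> c \<beta> = 0)"

definition recurs ::
    "nat \<Rightarrow> nat \<Rightarrow> (nat set \<Rightarrow> 'g::ab_group_add) set \<Rightarrow> 'g set \<Rightarrow> ('g \<Rightarrow> nat) \<Rightarrow> bool" where
  "recurs N M A Y col \<longleftrightarrow>
    (\<exists>a\<in>Y. \<exists>\<alpha>\<subseteq>{N..<M}. \<alpha> \<noteq> {} \<and> (\<forall>c\<in>A. col (a + set_poly c \<alpha>) = col a))"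

text \<open>The finite set \<open>Y\<close> and the bound \<open>M\<close> do not depend on the colouring; this uniformity is what
  lets colour focusing encode the colours near a point as a single colour.\<close>

definition vdw :: "nat \<Rightarrow> (nat set \<Rightarrow> 'g::ab_group_add) set \<Rightarrow> bool" where
  "vdw N A \<longleftrightarrow>
    (\<forall>r. \<exists>Y M. finite Y \<and> (\<forall>col. (\<forall>x. col x < r) \<longrightarrow> recurs N M A Y col))"

lemma vdwE:
  assumes "vdw N A"
  obtains Y M where "finite Y" "\<forall>col. (\<forall>x. col x < r) \<longrightarrow> recurs N M A Y col"
  using assms unfolding vdw_def by (elim allE[of _ r] exE conjE) (rule that)

text \<open>From one common point, \<open>s\<close> distinct colours are visible, each taken by the
  whole family along its own \<alpha>. If the point itself has one of these colours, the family
  recurs.\<close>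

definition focused ::
    "nat \<Rightarrow> nat \<Rightarrow> (nat set \<Rightarrow> 'g::ab_group_add) set \<Rightarrow> 'g set \<Rightarrow> nat \<Rightarrow> ('g \<Rightarrow> nat) \<Rightarrow> bool" where
  "focused N M A Y s col \<longleftrightarrow> (\<exists>a\<in>Y. \<exists>K. finite K \<and> card K = s \<and>
    (\<forall>k\<in>K. \<exists>\<alpha>\<subseteq>{N..<M}. \<alpha> \<noteq> {} \<and> (\<forall>c\<in>A. col (a + set_poly c \<alpha>) = k)))"

lemma set_poly_diff: "set_poly (\<lambda>\<beta>. c \<beta> - d \<beta>) \<alpha> = set_poly c \<alpha> - set_poly d \<alpha>"
  by (simp add: set_poly_def sum_subtractf)

lemma shift_empty [simp]: "shift {} c = c"
  by (simp add: shift_def fun_eq_iff)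

text \<open>A nonempty subset of \<gamma> \<union> \<delta> either lies in \<gamma> or splits
  uniquely into a nonempty part in \<delta> and an arbitrary part in \<gamma>.\<close>

lemma set_poly_Un:
  assumes "finite \<gamma>" "finite \<delta>" "\<gamma> \<inter> \<delta> = {}"
  shows "set_poly c (\<gamma> \<union> \<delta>) = set_poly c \<gamma> + set_poly (shift \<gamma> c) \<delta>"
proof -
  define f :: "nat set \<times> nat set \<Rightarrow> nat set" where "f = (\<lambda>(\<beta>, \<epsilon>). \<epsilon> \<union> \<beta>)"
  define D where "D = (Pow \<delta> - {{}}) \<times> Pow \<gamma>"
  have split: "Pow (\<gamma> \<union> \<delta>) - {{}} = (Pow \<gamma> - {{}}) \<union> f ` D"
  proof (intro equalityI subsetI)
    fix \<beta> assume \<beta>: "\<beta> \<in> Pow (\<gamma> \<union> \<delta>) - {{}}"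
    show "\<beta> \<in> (Pow \<gamma> - {{}}) \<union> f ` D"
    proof (cases "\<beta> \<inter> \<delta> = {}")
      case False
      have "\<beta> = f (\<beta> \<inter> \<delta>, \<beta> \<inter> \<gamma>)" "(\<beta> \<inter> \<delta>, \<beta> \<inter> \<gamma>) \<in> D"
        using \<beta> False by (auto simp: f_def D_def)
      then show ?thesis by blast
    qed (use \<beta> in auto)
  qed (auto simp: f_def D_def)
  have inj: "inj_on f D"
  proof (rule inj_onI)
    fix x y assume "x \<in> D" "y \<in> D" "f x = f y"
    moreover have "x = (f x \<inter> \<delta>, f x \<inter> \<gamma>)" if "x \<in> D" for x
      using that assms(3) by (auto simp: f_def D_def)
    ultimately show "x = y" by metis
  qed
  have "set_poly c (\<gamma> \<union> \<delta>) = set_poly c \<gamma> + (\<Sum>\<beta>\<in>f ` D. c \<beta>)"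
    unfolding set_poly_def split
    by (rule sum.union_disjoint) (use assms in \<open>auto simp: f_def D_def\<close>)
  also have "(\<Sum>\<beta>\<in>f ` D. c \<beta>) = set_poly (shift \<gamma> c) \<delta>"
    unfolding sum.reindex[OF inj]
    by (simp add: set_poly_def shift_def sum.cartesian_product D_def f_def case_prod_unfold)
  finally show ?thesis .
qed

lemma vanishing_mono:
  assumes "vanishing N d c" "N \<le> N'" "d \<le> d'"
  shows "vanishing N' d' c"
  unfolding vanishing_def
proof (intro allI impI)
  fix \<beta> assume \<beta>: "finite \<beta> \<and> \<beta> \<noteq> {} \<and> \<beta> \<subseteq> {N'..} \<and> d' \<le> card \<beta>"
  then have "\<beta> \<subseteq> {N..}" "d \<le> card \<beta>" using assms(2,3) by auto
  then show "c \<beta> = 0" using assms(1) \<beta> by (simp add: vanishing_def)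
qed

lemma set_poly_vanishing:
  assumes "vanishing N 0 c" "finite \<alpha>" "\<alpha> \<subseteq> {N..}"
  shows "set_poly c \<alpha> = 0"
  unfolding set_poly_def
proof (rule sum.neutral, rule ballI)
  fix \<beta> assume "\<beta> \<in> Pow \<alpha> - {{}}"
  then have "finite \<beta>" "\<beta> \<noteq> {}" "\<beta> \<subseteq> {N..}"
    using assms(2,3) finite_subset by auto
  then show "c \<beta> = 0" using assms(1) by (simp add: vanishing_def)
qed

text \<open>Each extra term of the shift enlarges \<beta> by a nonempty part of \<gamma>, which is
  disjoint from \<beta> because \<beta> starts at \<open>M\<close>. So shifting leaves the leading
  term unchanged.\<close>

lemma vanishing_shift_diff:
  assumes c: "vanishing N (Suc d) c" and \<gamma>: "\<gamma> \<subseteq> {N..<M}" and NM: "N \<le> M"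
  shows "vanishing M d (\<lambda>\<beta>. shift \<gamma> c \<beta> - c \<beta>)"
  unfolding vanishing_def
proof (intro allI impI)
  fix \<beta> assume \<beta>: "finite \<beta> \<and> \<beta> \<noteq> {} \<and> \<beta> \<subseteq> {M..} \<and> d \<le> card \<beta>"
  have fin: "finite \<gamma>" using \<gamma> by (rule finite_subset) simp
  have "c (\<epsilon> \<union> \<beta>) = 0" if \<epsilon>: "\<epsilon> \<in> Pow \<gamma> - {{}}" for \<epsilon>
  proof -
    have "finite \<epsilon>" using \<epsilon> fin by (auto intro: finite_subset)
    moreover have "\<epsilon> \<inter> \<beta> = {}" using \<epsilon> \<gamma> \<beta> by fastforce
    ultimately have "card (\<epsilon> \<union> \<beta>) = card \<epsilon> + card \<beta>" "card \<epsilon> > 0"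
      using \<beta> \<epsilon> by (auto simp: card_Un_disjoint card_gt_0_iff)
    then have "Suc d \<le> card (\<epsilon> \<union> \<beta>)" using \<beta> by simp
    moreover have "\<epsilon> \<union> \<beta> \<subseteq> {N..}" using \<epsilon> \<gamma> \<beta> NM by fastforce
    ultimately show ?thesis
      using c \<beta> \<open>finite \<epsilon>\<close> by (simp add: vanishing_def)
  qed
  then have "(\<Sum>\<epsilon>\<in>Pow \<gamma> - {{}}. c (\<epsilon> \<union> \<beta>)) = 0" by simp
  moreover have "shift \<gamma> c \<beta> = c ({} \<union> \<beta>) + (\<Sum>\<epsilon>\<in>Pow \<gamma> - {{}}. c (\<epsilon> \<union> \<beta>))"
    unfolding shift_def by (rule sum.remove) (use fin in auto)
  ultimately show "shift \<gamma> c \<beta> - c \<beta> = 0" by simp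
qed

section \<open>Colour focusing\<close>

text \<open>Only finitely many \<open>r\<close>-colourings of a finite window \<open>Z\<close>
  exist, so numbering them turns a whole pattern into a single colour below
  \<open>R\<close>.\<close>

lemma colour_patterns:
  fixes Z :: "'g set" and r :: nat
  assumes "finite Z"
  shows "\<exists>(R::nat) enc. \<forall>f g. (\<forall>z. f z < r) \<and> (\<forall>z. g z < r) \<longrightarrow>
    enc f < R \<and> (enc f = enc g \<longrightarrow> (\<forall>z\<in>Z. f z = g z))"
proof -
  define X where "X = (Z \<rightarrow>\<^sub>E {..<r})"
  have "finite X" unfolding X_def using assms by (intro finite_PiE) auto
  then obtain h where h: "bij_betw h X {0..<card X}"
    using ex_bij_betw_finite_nat by blast
  show ?thesis
  proof (rule exI[of _ "card X"], rule exI[of _ "\<lambda>f. h (restrict f Z)"], intro allI impI conjI)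
    fix f g :: "'g \<Rightarrow> nat"
    assume "(\<forall>z. f z < r) \<and> (\<forall>z. g z < r)"
    then have X: "restrict f Z \<in> X" "restrict g Z \<in> X" by (auto simp: X_def)
    then show "h (restrict f Z) < card X" using h by (auto simp: bij_betw_def)
    assume "h (restrict f Z) = h (restrict g Z)"
    then have "restrict f Z = restrict g Z" using h X by (auto simp: bij_betw_def inj_on_def)
    then show "\<forall>z\<in>Z. f z = g z" by (metis restrict_apply')
  qed
qed

text \<open>By induction on \<open>s\<close>, either the family recurs or \<open>s\<close> colours
  are focused at one point; \<open>s = r + 1\<close> rules out the second alternative.\<close>

lemma colour_focusing:
  fixes A :: "(nat set \<Rightarrow> 'g::ab_group_add) set"
  assumes A: "finite A" "A \<noteq> {}"
    and IH: "\<And>M. N \<le> M \<Longrightarrow>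
      vdw M ((\<lambda>(\<gamma>, c) \<beta>. shift \<gamma> c \<beta> - c1 \<beta>) ` (Pow {N..<M} \<times> A))"
  shows "vdw N A"
  unfolding vdw_def
proof
  fix r :: nat
  have "\<exists>Y M. finite Y \<and> N \<le> M \<and>
      (\<forall>col. (\<forall>x. col x < r) \<longrightarrow> recurs N M A Y col \<or> focused N M A Y s col)" for s
  proof (induction s)
    case 0
    show ?case by (intro exI[of _ "{0}"] exI[of _ N]) (auto simp: focused_def)
  next
    case (Suc s)
    then obtain Y M where Y: "finite Y" and NM: "N \<le> M"
      and step: "\<And>col. (\<forall>x. col x < r) \<Longrightarrow> recurs N M A Y col \<or> focused N M A Y s col"
      by blast
    \<comment> \<open>The window holds every point that the induction hypothesis for
      \<open>s\<close> may inspect.\<close>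
    define Z where
      "Z = (\<Union>a\<in>Y. \<Union>\<alpha>\<in>Pow {N..<M}. (\<lambda>c. a + set_poly c \<alpha>) ` A)"
    have "finite Z" using Y A by (auto simp: Z_def)
    from colour_patterns[OF this, of r] obtain R :: nat and enc
      where enc: "\<forall>f g. (\<forall>z. f z < r) \<and> (\<forall>z. g z < r) \<longrightarrow>
        enc f < R \<and> (enc f = enc g \<longrightarrow> (\<forall>z\<in>Z. f z = g z))"
      by (elim exE) (rule that)
    define B where "B = (\<lambda>(\<gamma>, c) \<beta>. shift \<gamma> c \<beta> - c1 \<beta>) ` (Pow {N..<M} \<times> A)"
    have "vdw M B" unfolding B_def by (rule IH[OF NM])
    then obtain X M' where X: "finite X"
      and M': "\<forall>col. (\<forall>x. col x < R) \<longrightarrow> recurs M M' B X col"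
      by (rule vdwE)
    \<comment> \<open>All possible base points are listed in advance: \<open>x + a\<close> for
      recurrence, and its translates by \<open>- set_poly c1 \<delta>\<close> for the new
      focus.\<close>
    define Y' where "Y' = (\<Union>x\<in>X. \<Union>a\<in>Y. insert (x + a)
      ((\<lambda>\<delta>. x + a - set_poly c1 \<delta>) ` Pow {M..<M'}))"
    have "recurs N (max M M') A Y' col \<or> focused N (max M M') A Y' (Suc s) col"
      if col: "\<forall>x. col x < r" for col
    proof -
      \<comment> \<open>The reduced family is applied to the colouring that gives \<open>x\<close>
        the pattern of \<open>col\<close> on the window translated to \<open>x\<close>.\<close>
      have "recurs M M' B X (\<lambda>x. enc (\<lambda>z. col (x + z)))"
        by (rule M'[rule_format]) (use col enc in simp)
      then obtain x \<delta> where x: "x \<in> X" and \<delta>: "\<delta> \<subseteq> {M..<M'}" "\<delta> \<noteq> {}"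
        and B: "\<forall>b\<in>B. enc (\<lambda>z. col (x + set_poly b \<delta> + z)) = enc (\<lambda>z. col (x + z))"
        unfolding recurs_def by blast
      have same: "enc (\<lambda>z. col (x + set_poly (\<lambda>\<beta>. shift \<gamma> c \<beta> - c1 \<beta>) \<delta> + z)) =
          enc (\<lambda>z. col (x + z))" if "c \<in> A" "\<gamma> \<subseteq> {N..<M}" for c \<gamma>
      proof (rule B[rule_format])
        show "(\<lambda>\<beta>. shift \<gamma> c \<beta> - c1 \<beta>) \<in> B"
          unfolding B_def by (rule image_eqI[of _ _ "(\<gamma>, c)"]) (use that in auto)
      qed
      have fin\<delta>: "finite \<delta>" using \<delta>(1) by (rule finite_subset) simp
      \<comment> \<open>With b = \<open>shift \<gamma> c - c1\<close>, the point on the left is x +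
        b(\<delta>) + (a + c(\<gamma>)), and the window at x + b(\<delta>) looks like the one at
        x.\<close>
      have colour: "col (x + a - set_poly c1 \<delta> + set_poly c (\<gamma> \<union> \<delta>)) = col (x + (a + set_poly c \<gamma>))"
        if "a \<in> Y" "c \<in> A" "\<gamma> \<subseteq> {N..<M}" for a c \<gamma>
      proof -
        have "a + set_poly c \<gamma> \<in> Z" using that by (auto simp: Z_def)
        then have "col (x + set_poly (\<lambda>\<beta>. shift \<gamma> c \<beta> - c1 \<beta>) \<delta> + (a + set_poly c \<gamma>)) =
            col (x + (a + set_poly c \<gamma>))"
          using enc[rule_format, of "\<lambda>z. col (x + set_poly (\<lambda>\<beta>. shift \<gamma> c \<beta> - c1 \<beta>) \<delta> + z)"
              "\<lambda>z. col (x + z)"] same[OF that(2,3)] col by simp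
        moreover have "set_poly c (\<gamma> \<union> \<delta>) = set_poly c \<gamma> + set_poly (shift \<gamma> c) \<delta>"
        proof (rule set_poly_Un)
          show "finite \<gamma>" using that(3) by (rule finite_subset) simp
          show "\<gamma> \<inter> \<delta> = {}" using that(3) \<delta>(1) by fastforce
        qed (rule fin\<delta>)
        ultimately show ?thesis by (simp add: set_poly_diff algebra_simps)
      qed
      have monoI: "recurs N (max M M') A Y' col"
        if "a \<in> Y" "\<alpha> \<subseteq> {N..<M}" "\<alpha> \<noteq> {}"
          "\<forall>c\<in>A. col (x + (a + set_poly c \<alpha>)) = col (x + a)" for a \<alpha>
        unfolding recurs_def
      proof (intro bexI[of _ "x + a"] exI[of _ \<alpha>] conjI)
        show "\<forall>c\<in>A. col (x + a + set_poly c \<alpha>) = col (x + a)"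
          using that(4) by (simp add: add.assoc)
        show "\<alpha> \<subseteq> {N..<max M M'}" using that(2) by fastforce
      qed (use that x in \<open>auto simp: Y'_def\<close>)
      have "recurs N M A Y (\<lambda>y. col (x + y)) \<or> focused N M A Y s (\<lambda>y. col (x + y))"
        by (rule step) (use col in blast)
      then consider "recurs N M A Y (\<lambda>y. col (x + y))" | "focused N M A Y s (\<lambda>y. col (x + y))"
        by blast
      then show ?thesis
      proof cases
        case 1
        then show ?thesis using monoI unfolding recurs_def by blast
      next
        case 2
        then obtain a K where a: "a \<in> Y" and K: "finite K" "card K = s"
          "\<And>k. k \<in> K \<Longrightarrow> \<exists>\<alpha>\<subseteq>{N..<M}. \<alpha> \<noteq> {} \<and> (\<forall>c\<in>A. col (x + (a + set_poly c \<alpha>)) = k)"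
          unfolding focused_def by blast
        show ?thesis
        proof (cases "col (x + a) \<in> K")
          case True
          from K(3)[OF this] obtain \<alpha> where "\<alpha> \<subseteq> {N..<M}" "\<alpha> \<noteq> {}"
            "\<forall>c\<in>A. col (x + (a + set_poly c \<alpha>)) = col (x + a)"
            by (elim exE conjE) (rule that)
          then have "recurs N (max M M') A Y' col" by (rule monoI[OF a])
          then show ?thesis ..
        next
          case False
          let ?a = "x + a - set_poly c1 \<delta>"
          have sub: "\<delta> \<subseteq> {N..<max M M'}" using \<delta>(1) NM by fastforce
          have "\<exists>\<alpha>\<subseteq>{N..<max M M'}. \<alpha> \<noteq> {} \<and> (\<forall>c\<in>A. col (?a + set_poly c \<alpha>) = k)"
            if k: "k \<in> insert (col (x + a)) K" for k
          proof (cases "k = col (x + a)")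
            case True
            \<comment> \<open>Taking \<gamma> empty shows the colour of \<open>x + a\<close> from
              the new focus; this is the additional colour.\<close>
            have "\<forall>c\<in>A. col (?a + set_poly c \<delta>) = k"
              using colour[OF a _ empty_subsetI] True by (simp add: set_poly_def)
            then show ?thesis using \<delta>(2) sub by blast
          next
            case False
            with k have "k \<in> K" by simp
            from K(3)[OF this] obtain \<alpha> where \<alpha>: "\<alpha> \<subseteq> {N..<M}" "\<alpha> \<noteq> {}"
              "\<forall>c\<in>A. col (x + (a + set_poly c \<alpha>)) = k"
              by (elim exE conjE) (rule that)
            \<comment> \<open>The old colours stay visible from the new focus once \<delta> is
              appended to their index sets.\<close>
            have "\<forall>c\<in>A. col (?a + set_poly c (\<alpha> \<union> \<delta>)) = k"
              using colour[OF a _ \<alpha>(1)] \<alpha>(3) by simp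
            moreover have "\<alpha> \<union> \<delta> \<subseteq> {N..<max M M'}" using \<alpha>(1) sub by fastforce
            ultimately show ?thesis using \<alpha>(2) by blast
          qed
          moreover have "?a \<in> Y'" using x a \<delta>(1) unfolding Y'_def by blast
          moreover have "card (insert (col (x + a)) K) = Suc s" using K False by simp
          ultimately have "focused N (max M M') A Y' (Suc s) col"
            unfolding focused_def using K(1)
            by (intro bexI[of _ ?a] exI[of _ "insert (col (x + a)) K"]) simp_all
          then show ?thesis ..
        qed
      qed
    qed
    moreover have "finite Y'" using X Y by (simp add: Y'_def)
    moreover have "N \<le> max M M'" using NM by simp
    ultimately show ?case by blast
  qed
  from this[of "Suc r"] obtain Y M where Y: "finite Y"
    and YM: "\<forall>col. (\<forall>x. col x < r) \<longrightarrow> recurs N M A Y col \<or> focused N M A Y (Suc r) col"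
    by (elim exE conjE) (rule that)
  have "\<not> focused N M A Y (Suc r) col" if col: "\<forall>x. col x < r" for col
  proof
    assume "focused N M A Y (Suc r) col"
    then obtain a K where K: "card K = Suc r"
      "\<forall>k\<in>K. \<exists>\<alpha>\<subseteq>{N..<M}. \<alpha> \<noteq> {} \<and> (\<forall>c\<in>A. col (a + set_poly c \<alpha>) = k)"
      unfolding focused_def by blast
    obtain c where "c \<in> A" using A(2) by blast
    have "K \<subseteq> {..<r}"
    proof
      fix k assume "k \<in> K"
      with K(2) obtain \<alpha> where "\<forall>c\<in>A. col (a + set_poly c \<alpha>) = k" by blast
      with \<open>c \<in> A\<close> have "col (a + set_poly c \<alpha>) = k" by blast
      with col show "k \<in> {..<r}" by auto
    qed
    then have "card K \<le> r" using card_mono[of "{..<r}" K] by simp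
    then show False using K(1) by simp
  qed
  with Y YM show "\<exists>Y M. finite Y \<and> (\<forall>col. (\<forall>x. col x < r) \<longrightarrow> recurs N M A Y col)"
    by blast
qed

section \<open>PET induction on the multiset of degrees\<close>

text \<open>A pair \<open>(d, e)\<close> stands for the set-polynomials of degree at most \<open>d\<close> whose leading term is that
  of \<open>e\<close>. The multiset of the degrees of a covering family of such pairs is the PET weight.\<close>

definition in_class :: "nat \<Rightarrow> nat \<times> (nat set \<Rightarrow> 'g::ab_group_add) \<Rightarrow> (nat set \<Rightarrow> 'g) \<Rightarrow> bool" where
  "in_class N \<equiv> \<lambda>(d, e) c. vanishing N (Suc d) c \<and> vanishing N d (\<lambda>\<beta>. c \<beta> - e \<beta>)"

lemma vanishing_0_iff: "vanishing N 0 c \<longleftrightarrow> vanishing N (Suc 0) c"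
  by (auto simp: vanishing_def Suc_le_eq card_gt_0_iff)

text \<open>A set-polynomial of this kind takes the value 0 on the index sets in question, so its
  point is the base point itself.\<close>

lemma vdw_remove_vanishing:
  assumes "vdw N {c\<in>A. \<not> vanishing N 0 c}"
  shows "vdw N A"
proof -
  have recurs_A: "recurs N M A Y col" if rec: "recurs N M {c\<in>A. \<not> vanishing N 0 c} Y col" for M Y col
  proof -
    obtain a \<alpha> where *: "a \<in> Y" "\<alpha> \<subseteq> {N..<M}" "\<alpha> \<noteq> {}"
        "\<forall>c\<in>{c\<in>A. \<not> vanishing N 0 c}. col (a + set_poly c \<alpha>) = col a"
      using rec unfolding recurs_def by blast
    have "finite \<alpha>" "\<alpha> \<subseteq> {N..}" using *(2) finite_subset by auto
    then have "col (a + set_poly c \<alpha>) = col a" if "c \<in> A" for c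
      using *(4) that by (cases "vanishing N 0 c") (simp_all add: set_poly_vanishing)
    with * show ?thesis unfolding recurs_def by blast
  qed
  show ?thesis
    unfolding vdw_def
  proof
    fix r
    obtain Y M where "finite Y"
      and YM: "\<forall>col. (\<forall>x. col x < r) \<longrightarrow> recurs N M {c\<in>A. \<not> vanishing N 0 c} Y col"
      using assms by (rule vdwE)
    then show "\<exists>Y M. finite Y \<and> (\<forall>col. (\<forall>x. col x < r) \<longrightarrow> recurs N M A Y col)"
      by (intro exI[of _ Y] exI[of _ M] conjI allI impI recurs_A YM[rule_format]) auto
  qed
qed

lemma vdw_empty: "vdw N {}"
proof -
  have "recurs N (Suc N) {} {0} col" for col :: "'a \<Rightarrow> nat"
    unfolding recurs_def by (intro bexI[of _ 0] exI[of _ "{N}"]) auto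
  then show ?thesis unfolding vdw_def by blast
qed

text \<open>Well-founded induction on the multiset of degrees. \<open>N\<close> must vary, since
  focusing passes from \<open>N\<close> to a larger \<open>M\<close>.\<close>

lemma vdw_if_covered:
  fixes A :: "(nat set \<Rightarrow> 'g::ab_group_add) set"
  assumes "finite A" "\<forall>c\<in>A. \<exists>x\<in>#L. in_class N x c"
  shows "vdw N A"
  using assms
proof (induction "image_mset fst L" arbitrary: L N A rule: wf_induct_rule[OF wf_mult[OF wf_less_than]])
  case 1
  define A' where "A' = {c\<in>A. \<not> vanishing N 0 c}"
  have A': "finite A'" "\<forall>c\<in>A'. \<exists>x\<in>#L. in_class N x c"
    using 1 by (auto simp: A'_def)
  have "vdw N A'"
  proof (cases "L = {#}")
    case True
    then have "A' = {}" using A' by auto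
    then show ?thesis by (simp add: vdw_empty)
  next
    case False
    define d1 where "d1 = Min (fst ` set_mset L)"
    have "d1 \<in> fst ` set_mset L" unfolding d1_def using False by (intro Min_in) auto
    then obtain e1 where e1: "(d1, e1) \<in># L" by auto
    have d1_le: "d1 \<le> d" if "(d, e) \<in># L" for d e
      unfolding d1_def using that by (intro Min_le) force+
    define L0 where "L0 = L - {#(d1, e1)#}"
    have L: "L = add_mset (d1, e1) L0" using e1 by (simp add: L0_def)
    show ?thesis
    proof (cases "\<exists>c\<in>A'. in_class N (d1, e1) c")
      \<comment> \<open>A pair that covers nothing is dropped, which already lowers the
        weight.\<close>
      case False
      have "(image_mset fst L0, image_mset fst L) \<in> mult less_than"
        using one_step_implies_mult[of "{#d1#}" "{#}" less_than "image_mset fst L0"] by (simp add: L)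
      then show ?thesis
        by (rule 1(1)) (use A' False in \<open>auto simp: L\<close>)
    next
      case True
      then obtain c1 where c1: "c1 \<in> A'" "vanishing N (Suc d1) c1"
          "vanishing N d1 (\<lambda>\<beta>. c1 \<beta> - e1 \<beta>)"
        by (auto simp: in_class_def)
      \<comment> \<open>Zero set-polynomials have been removed, so \<open>c1\<close> has positive
        degree and \<open>d1 - 1\<close> is a genuine decrease.\<close>
      have "d1 \<noteq> 0" using c1(1,2) by (cases d1) (auto simp: A'_def vanishing_0_iff)
      show ?thesis
      proof (rule colour_focusing[where ?c1.0 = c1])
        fix M assume NM: "N \<le> M"
        define B where "B = (\<lambda>(\<gamma>, c) \<beta>. shift \<gamma> c \<beta> - c1 \<beta>) ` (Pow {N..<M} \<times> A')"
        have finB: "finite B" using A' by (simp add: B_def)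
        \<comment> \<open>Subtracting \<open>c1\<close> alters the leading terms in degree
          \<open>d1\<close> only; those of higher degree survive.\<close>
        define f :: "nat \<times> (nat set \<Rightarrow> 'g) \<Rightarrow> nat \<times> (nat set \<Rightarrow> 'g)"
          where "f = (\<lambda>(d, e). (d, if d = d1 then (\<lambda>\<beta>. e \<beta> - c1 \<beta>) else e))"
        \<comment> \<open>The pair of \<open>c1\<close> is traded for finitely many pairs of degree
          \<open>d1 - 1\<close>, with the members of \<open>B\<close> themselves as
          representatives.\<close>
        define L' where "L' = image_mset f L0 + image_mset (Pair (d1 - 1)) (mset_set B)"
        have "(image_mset fst L0 + replicate_mset (card B) (d1 - 1), image_mset fst L0 + {#d1#})
            \<in> mult less_than"
          by (rule one_step_implies_mult) (use \<open>d1 \<noteq> 0\<close> in auto)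
        moreover have "image_mset fst L' = image_mset fst L0 + replicate_mset (card B) (d1 - 1)"
          by (simp add: L'_def f_def case_prod_unfold image_mset.compositionality comp_def
              image_mset_const_eq)
        ultimately have less: "(image_mset fst L', image_mset fst L) \<in> mult less_than"
          by (simp add: L)
        have "\<exists>x\<in>#L'. in_class M x b" if bB: "b \<in> B" for b
        proof -
          obtain \<gamma> c where \<gamma>: "\<gamma> \<subseteq> {N..<M}" and c: "c \<in> A'" and b: "b = (\<lambda>\<beta>. shift \<gamma> c \<beta> - c1 \<beta>)"
            using bB by (auto simp: B_def)
          obtain x where x: "x \<in># L" "in_class N x c" using A'(2) c by blast
          obtain d e where "x = (d, e)" by (cases x)
          with x have de: "(d, e) \<in># L" "vanishing N (Suc d) c" "vanishing N d (\<lambda>\<beta>. c \<beta> - e \<beta>)"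
            by (simp_all add: in_class_def)
          then have case_e: "(d, e) \<in># L0 \<or> (d, e) = (d1, e1)" by (auto simp: L)
          have "d1 \<le> d" using d1_le de(1) .
          have sh: "vanishing M d (\<lambda>\<beta>. shift \<gamma> c \<beta> - c \<beta>)"
            by (rule vanishing_shift_diff[OF de(2) \<gamma> NM])
          have ce: "vanishing M d (\<lambda>\<beta>. c \<beta> - e \<beta>)" "vanishing M (Suc d) c"
            using vanishing_mono[OF de(3) NM] vanishing_mono[OF de(2) NM] by auto
          have c1M: "vanishing M (Suc d1) c1" "vanishing M d1 (\<lambda>\<beta>. c1 \<beta> - e1 \<beta>)"
            using vanishing_mono[OF c1(2) NM] vanishing_mono[OF c1(3) NM] by auto
          \<comment> \<open>Minimality of \<open>d1\<close> ensures that subtracting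
            \<open>c1\<close> does not raise the degree.\<close>
          have bd: "vanishing M (Suc d) b"
            using vanishing_mono[OF sh le_refl, of "Suc d"] ce(2)
              vanishing_mono[OF c1M(1) le_refl, of "Suc d"] \<open>d1 \<le> d\<close>
            unfolding vanishing_def b by simp
          show ?thesis
          proof (cases "(d, e) \<in># L0")
            case True
            then have "f (d, e) \<in># L'" by (simp add: L'_def)
            moreover have "in_class M (f (d, e)) b"
            proof (cases "d = d1")
              case True
              then show ?thesis
                using bd sh ce(1) unfolding in_class_def f_def vanishing_def b by simp
            next
              case False
              then have "Suc d1 \<le> d" using \<open>d1 \<le> d\<close> by simp
              have "vanishing M d c1"
                by (rule vanishing_mono[OF c1M(1) le_refl \<open>Suc d1 \<le> d\<close>])
              then have "vanishing M d (\<lambda>\<beta>. b \<beta> - e \<beta>)"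
                using sh ce(1) unfolding vanishing_def b by simp
              then show ?thesis
                using False bd by (simp add: in_class_def f_def)
            qed
            ultimately show ?thesis by blast
          next
            case False
            then have [simp]: "d = d1" "e = e1" using case_e by auto
            \<comment> \<open>Here \<open>c\<close> and \<open>c1\<close> share the leading term of
              \<open>e1\<close>, which cancels in \<open>b\<close>.\<close>
            have "vanishing M d1 b"
              using sh ce(1) c1M(2) unfolding vanishing_def b by simp
            then have "in_class M (d1 - 1, b) b"
              using \<open>d1 \<noteq> 0\<close> by (simp add: in_class_def vanishing_def)
            moreover have "(d1 - 1, b) \<in># L'" using bB finB by (simp add: L'_def)
            ultimately show ?thesis by blast
          qed
        qed
        then show "vdw M ((\<lambda>(\<gamma>, c) \<beta>. shift \<gamma> c \<beta> - c1 \<beta>) ` (Pow {N..<M} \<times> A'))"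
          using 1(1)[OF less finB, of M] by (simp add: B_def)
      qed (use A' c1 in auto)
    qed
  qed
  then show ?case unfolding A'_def by (rule vdw_remove_vanishing)
qed

text \<open>Each \<open>c\<close> represents its own class, so finitely many pairs cover the
  family.\<close>

lemma vdw_set_polynomials:
  fixes A :: "(nat set \<Rightarrow> 'g::ab_group_add) set"
  assumes "finite A" "\<And>c. c \<in> A \<Longrightarrow> \<exists>d. vanishing N d c"
  shows "vdw N A"
proof -
  obtain d where d: "\<And>c. c \<in> A \<Longrightarrow> vanishing N (d c) c" using assms(2) by metis
  have "in_class N (d c, c) c" if "c \<in> A" for c
    using vanishing_mono[OF d[OF that] le_refl, of "Suc (d c)"]
    by (simp add: in_class_def vanishing_def)
  then have "\<forall>c\<in>A. \<exists>x\<in>#image_mset (\<lambda>c. (d c, c)) (mset_set A). in_class N x c"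
    using assms(1) by auto
  then show ?thesis by (rule vdw_if_covered[OF assms(1)])
qed

section \<open>From ordinary polynomials to set-polynomials\<close>

definition is_set_poly :: "(nat set \<Rightarrow> 'a::comm_ring_1) \<Rightarrow> bool" where
  "is_set_poly g \<longleftrightarrow> (\<exists>c d. (\<forall>\<beta>. d < card \<beta> \<longrightarrow> c \<beta> = 0) \<and>
    (\<forall>\<alpha>. finite \<alpha> \<longrightarrow> g \<alpha> = (\<Sum>\<beta>\<in>Pow \<alpha>. c \<beta>)))"

lemma is_set_poly_const: "is_set_poly (\<lambda>_. k)"
  unfolding is_set_poly_def
proof (intro exI conjI allI impI)
  fix \<alpha> :: "nat set" assume "finite \<alpha>"
  then show "k = (\<Sum>\<beta>\<in>Pow \<alpha>. if \<beta> = {} then k else 0)" by simp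
qed auto

lemma is_set_poly_sum_elements: "is_set_poly (\<lambda>\<alpha>. \<Sum>i\<in>\<alpha>. u i)"
  unfolding is_set_poly_def
proof (intro exI conjI allI impI)
  let ?c = "\<lambda>\<beta>. if is_singleton \<beta> then u (the_elem \<beta>) else 0"
  show "?c \<beta> = 0" if "1 < card \<beta>" for \<beta>
    using that by (simp add: is_singleton_altdef)
  fix \<alpha> :: "nat set" assume \<alpha>: "finite \<alpha>"
  have "(\<Sum>\<beta>\<in>Pow \<alpha>. ?c \<beta>) = (\<Sum>\<beta>\<in>(\<lambda>i. {i}) ` \<alpha>. ?c \<beta>)"
    by (rule sum.mono_neutral_right) (use \<alpha> in \<open>auto elim!: is_singletonE\<close>)
  also have "\<dots> = (\<Sum>i\<in>\<alpha>. u i)" by (subst sum.reindex) auto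
  finally show "(\<Sum>i\<in>\<alpha>. u i) = (\<Sum>\<beta>\<in>Pow \<alpha>. ?c \<beta>)" ..
qed

lemma is_set_poly_add:
  assumes "is_set_poly g" "is_set_poly h"
  shows "is_set_poly (\<lambda>\<alpha>. g \<alpha> + h \<alpha>)"
proof -
  obtain c d where c: "\<forall>\<beta>. d < card \<beta> \<longrightarrow> c \<beta> = 0" "\<forall>\<alpha>. finite \<alpha> \<longrightarrow> g \<alpha> = (\<Sum>\<beta>\<in>Pow \<alpha>. c \<beta>)"
    using assms(1) unfolding is_set_poly_def by blast
  obtain c' d' where c': "\<forall>\<beta>. d' < card \<beta> \<longrightarrow> c' \<beta> = 0" "\<forall>\<alpha>. finite \<alpha> \<longrightarrow> h \<alpha> = (\<Sum>\<beta>\<in>Pow \<alpha>. c' \<beta>)"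
    using assms(2) unfolding is_set_poly_def by blast
  show ?thesis
    unfolding is_set_poly_def
    by (intro exI[of _ "\<lambda>\<beta>. c \<beta> + c' \<beta>"] exI[of _ "max d d'"])
      (use c c' in \<open>simp add: sum.distrib\<close>)
qed

text \<open>Products of coefficients are grouped by the union of their supports; a union has at most
  the sum of the two sizes, so degrees add.\<close>

lemma is_set_poly_mult:
  assumes "is_set_poly g" "is_set_poly h"
  shows "is_set_poly (\<lambda>\<alpha>. g \<alpha> * h \<alpha>)"
proof -
  obtain c d where c: "\<forall>\<beta>. d < card \<beta> \<longrightarrow> c \<beta> = 0" "\<forall>\<alpha>. finite \<alpha> \<longrightarrow> g \<alpha> = (\<Sum>\<beta>\<in>Pow \<alpha>. c \<beta>)"
    using assms(1) unfolding is_set_poly_def by blast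
  obtain c' d' where c': "\<forall>\<beta>. d' < card \<beta> \<longrightarrow> c' \<beta> = 0" "\<forall>\<alpha>. finite \<alpha> \<longrightarrow> h \<alpha> = (\<Sum>\<beta>\<in>Pow \<alpha>. c' \<beta>)"
    using assms(2) unfolding is_set_poly_def by blast
  let ?S = "\<lambda>\<beta>. {x \<in> Pow \<beta> \<times> Pow \<beta>. fst x \<union> snd x = \<beta>}"
  let ?c = "\<lambda>\<beta>. \<Sum>x\<in>?S \<beta>. c (fst x) * c' (snd x)"
  show ?thesis
    unfolding is_set_poly_def
  proof (intro exI conjI allI impI)
    fix \<beta> :: "nat set" assume \<beta>: "d + d' < card \<beta>"
    show "?c \<beta> = 0"
    proof (rule sum.neutral, rule ballI)
      fix x assume "x \<in> ?S \<beta>"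
      then have "card \<beta> \<le> card (fst x) + card (snd x)"
        using card_Un_le[of "fst x" "snd x"] by auto
      then have "d < card (fst x) \<or> d' < card (snd x)" using \<beta> by linarith
      then show "c (fst x) * c' (snd x) = 0" using c(1) c'(1) by auto
    qed
  next
    fix \<alpha> :: "nat set" assume \<alpha>: "finite \<alpha>"
    have "g \<alpha> * h \<alpha> = (\<Sum>x\<in>Pow \<alpha> \<times> Pow \<alpha>. c (fst x) * c' (snd x))"
      using \<alpha> c(2) c'(2) by (simp add: sum_product sum.cartesian_product case_prod_unfold)
    also have "\<dots> = (\<Sum>\<beta>\<in>Pow \<alpha>. \<Sum>x\<in>{x \<in> Pow \<alpha> \<times> Pow \<alpha>. fst x \<union> snd x = \<beta>}. c (fst x) * c' (snd x))"
      by (rule sum.group[symmetric]) (use \<alpha> in auto)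
    also have "\<dots> = (\<Sum>\<beta>\<in>Pow \<alpha>. ?c \<beta>)"
      by (intro sum.cong) auto
    finally show "g \<alpha> * h \<alpha> = (\<Sum>\<beta>\<in>Pow \<alpha>. ?c \<beta>)" .
  qed
qed

lemma is_set_poly_sum:
  "(\<And>x. x \<in> X \<Longrightarrow> is_set_poly (g x)) \<Longrightarrow> is_set_poly (\<lambda>\<alpha>. \<Sum>x\<in>X. g x \<alpha>)"
  by (induction X rule: infinite_finite_induct) (auto intro: is_set_poly_const is_set_poly_add)

lemma is_set_poly_prod:
  "(\<And>x. x \<in> X \<Longrightarrow> is_set_poly (g x)) \<Longrightarrow> is_set_poly (\<lambda>\<alpha>. \<Prod>x\<in>X. g x \<alpha>)"
  by (induction X rule: infinite_finite_induct) (auto intro: is_set_poly_const is_set_poly_mult)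

lemma is_set_poly_power: "is_set_poly g \<Longrightarrow> is_set_poly (\<lambda>\<alpha>. g \<alpha> ^ k)"
  by (induction k) (auto intro: is_set_poly_const is_set_poly_mult)

text \<open>Each coordinate of an IP-sum is a set-polynomial of degree at most 1, and the closure
  properties carry this through the monomials of \<open>P\<close>.\<close>

lemma polynomial_mapping_set_poly:
  fixes P :: "int ^ 't \<Rightarrow> int ^ 'm" and u :: "nat \<Rightarrow> int ^ 't"
  assumes P: "polynomial_mapping P" and P0: "P 0 = 0"
  shows "\<exists>c :: nat set \<Rightarrow> rat ^ 'm. (\<exists>d. vanishing 0 d c) \<and>
    (\<forall>\<alpha>. finite \<alpha> \<longrightarrow>
      set_poly c \<alpha> = (\<chi> j. of_int (P (\<chi> i. (\<Sum>k\<in>\<alpha>. u k) $ i * v $ i) $ j)))"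
proof -
  define g :: "'m \<Rightarrow> nat set \<Rightarrow> rat" where
    "g = (\<lambda>j \<alpha>. of_int (P (\<chi> i. (\<Sum>k\<in>\<alpha>. u k) $ i * v $ i) $ j))"
  have "is_set_poly (g j)" for j
  proof -
    obtain q where q: "rat_polynomial q" "\<forall>n. of_int (P n $ j) = q (\<chi> i. of_int (n $ i))"
      using P unfolding polynomial_mapping_def by blast
    then obtain A :: "('t \<Rightarrow> nat) set" and a
      where a: "\<forall>x. q x = (\<Sum>\<mu>\<in>A. a \<mu> * (\<Prod>i\<in>UNIV. (x $ i) ^ \<mu> i))"
      unfolding rat_polynomial_def by blast
    have "g j = (\<lambda>\<alpha>. \<Sum>\<mu>\<in>A. a \<mu> *
        (\<Prod>i\<in>UNIV. ((\<Sum>k\<in>\<alpha>. of_int (u k $ i)) * of_int (v $ i)) ^ \<mu> i))"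
      using q(2) a by (simp add: g_def fun_eq_iff)
    then show ?thesis
      by (auto intro!: is_set_poly_sum is_set_poly_mult is_set_poly_const is_set_poly_prod
          is_set_poly_power is_set_poly_sum_elements)
  qed
  then obtain c d where cd: "\<And>j \<beta>. d j < card \<beta> \<Longrightarrow> c j \<beta> = 0"
      "\<And>j \<alpha>. finite \<alpha> \<Longrightarrow> g j \<alpha> = (\<Sum>\<beta>\<in>Pow \<alpha>. c j \<beta>)"
    unfolding is_set_poly_def by metis
  \<comment> \<open>The sum of the coordinate degrees serves as a common bound.\<close>
  have "vanishing 0 (Suc (\<Sum>j\<in>UNIV. d j)) (\<lambda>\<beta>. \<chi> j. c j \<beta>)"
    unfolding vanishing_def
  proof (intro allI impI)
    fix \<beta> :: "nat set"
    assume \<beta>: "finite \<beta> \<and> \<beta> \<noteq> {} \<and> \<beta> \<subseteq> {0..} \<and> Suc (\<Sum>j\<in>UNIV. d j) \<le> card \<beta>"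
    have "d j < card \<beta>" for j
      using \<beta> member_le_sum[of j UNIV d] by simp
    then show "(\<chi> j. c j \<beta>) = 0" by (simp add: cd(1) vec_eq_iff)
  qed
  moreover have "set_poly (\<lambda>\<beta>. \<chi> j. c j \<beta>) \<alpha> = (\<chi> j. g j \<alpha>)" if \<alpha>: "finite \<alpha>" for \<alpha>
  proof -
    \<comment> \<open>The hypothesis P(0) = 0 kills the coefficient at the empty set, which
      \<open>set_poly\<close> leaves out.\<close>
    have "g j {} = 0" for j
      using P0 by (simp add: g_def zero_vec_def)
    then have "c j {} = 0" for j using cd(2)[of "{}" j] by simp
    then have "g j \<alpha> = (\<Sum>\<beta>\<in>Pow \<alpha> - {{}}. c j \<beta>)" for j
      using \<alpha> cd(2)[OF \<alpha>, of j] sum.remove[of "Pow \<alpha>" "{}" "c j"] by simp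
    then show ?thesis by (simp add: set_poly_def vec_eq_iff)
  qed
  ultimately show ?thesis unfolding g_def by blast
qed

section \<open>Deduction of the IP* statement from the van der Waerden theorem for
  set-polynomials\<close>

theorem theorem0p14:
  fixes P :: "int ^ 't \<Rightarrow> int ^ 'm"
    and F :: "(int ^ 't) set"
    and col :: "int ^ 'm \<Rightarrow> nat"
    and r :: nat
  assumes "polynomial_mapping P"
    and "P 0 = 0"
    and "finite F"
    and "\<And>x. col x \<in> {1..r}"
  shows "\<exists>l\<in>{1..r}. IP_star_set
    {n :: int ^ 't. \<exists>a :: int ^ 'm. \<forall>v\<in>F. col (a + P (\<chi> i. n $ i * v $ i)) = l}"
proof (rule ccontr)
  let ?S = "\<lambda>l. {n :: int ^ 't. \<exists>a :: int ^ 'm. \<forall>v\<in>F. col (a + P (\<chi> i. n $ i * v $ i)) = l}"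
  assume "\<not> ?thesis"
  then have "\<forall>l\<in>{1..r}. \<exists>u. ?S l \<inter> IP_set_gen u = {}"
    unfolding IP_star_set_def by blast
  from bchoice[OF this] obtain u where u: "\<And>l. l \<in> {1..r} \<Longrightarrow> ?S l \<inter> IP_set_gen (u l) = {}"
    by blast
  define Q :: "nat \<Rightarrow> int ^ 't \<Rightarrow> (nat set \<Rightarrow> rat ^ 'm) \<Rightarrow> bool" where
    "Q l v c \<longleftrightarrow> (\<exists>d. vanishing 0 d c) \<and> (\<forall>\<alpha>. finite \<alpha> \<longrightarrow>
      set_poly c \<alpha> = (\<chi> j. of_int (P (\<chi> i. (\<Sum>k\<in>\<alpha>. u l k) $ i * v $ i) $ j)))" for l v c
  have "\<exists>c. Q l v c" for l v
    unfolding Q_def by (rule polynomial_mapping_set_poly[OF assms(1,2)])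
  then obtain c where Q: "\<And>l v. Q l v (c l v)" by metis
  then have c: "\<And>l v. \<exists>d. vanishing 0 d (c l v)"
      "\<And>l v \<alpha>. finite \<alpha> \<Longrightarrow>
        set_poly (c l v) \<alpha> = (\<chi> j. of_int (P (\<chi> i. (\<Sum>k\<in>\<alpha>. u l k) $ i * v $ i) $ j))"
    unfolding Q_def by blast+
  \<comment> \<open>All colours enter at once because the relevant \<open>l\<close> is known only
    after a configuration has been found.\<close>
  define A where "A = (\<lambda>(l, v). c l v) ` ({1..r} \<times> F)"
  have "vdw 0 A"
    by (rule vdw_set_polynomials) (use assms(3) c(1) in \<open>auto simp: A_def\<close>)
  \<comment> \<open>The coefficients of the set-polynomials are only known to be rational, so the colouring is
    extended to rational vectors; rounding commutes with adding the integral values of \<open>P\<close>.\<close>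
  define fl :: "rat ^ 'm \<Rightarrow> int ^ 'm" where "fl = (\<lambda>x. \<chi> j. \<lfloor>x $ j\<rfloor>)"
  \<comment> \<open>Colours run from 1 to \<open>r\<close>, whereas \<open>vdw\<close> counts from
    0, hence \<open>Suc r\<close>.\<close>
  have "\<forall>x. col (fl x) < Suc r" using assms(4) by (simp add: less_Suc_eq_le)
  moreover obtain Y M where YM: "\<forall>col'. (\<forall>x. col' x < Suc r) \<longrightarrow> recurs 0 M A Y col'"
    using \<open>vdw 0 A\<close> by (rule vdwE)
  ultimately have "recurs 0 M A Y (\<lambda>x. col (fl x))"
    by (intro YM[rule_format]) simp
  then obtain a \<alpha> where \<alpha>: "\<alpha> \<subseteq> {0..<M}" "\<alpha> \<noteq> {}"
      "\<And>c. c \<in> A \<Longrightarrow> col (fl (a + set_poly c \<alpha>)) = col (fl a)"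
    unfolding recurs_def by blast
  have fin: "finite \<alpha>" using \<alpha>(1) by (rule finite_subset) simp
  \<comment> \<open>The colour of the base point decides which of the IP-sets is hit.\<close>
  define l where "l = col (fl a)"
  have l: "l \<in> {1..r}" unfolding l_def by (rule assms(4))
  let ?n = "\<Sum>k\<in>\<alpha>. u l k"
  have "col (fl a + P (\<chi> i. ?n $ i * v $ i)) = l" if "v \<in> F" for v
  proof -
    have "c l v \<in> A" using that l by (force simp: A_def)
    then have "col (fl (a + set_poly (c l v) \<alpha>)) = l" using \<alpha>(3) by (simp add: l_def)
    moreover have "fl (a + set_poly (c l v) \<alpha>) = fl a + P (\<chi> i. ?n $ i * v $ i)"
      unfolding c(2)[OF fin] by (simp add: fl_def vec_eq_iff)
    ultimately show ?thesis by simp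
  qed
  then have "?n \<in> ?S l" by blast
  moreover have "?n \<in> IP_set_gen (u l)" using fin \<alpha>(2) by (auto simp: IP_set_gen_def)
  ultimately show False using u[OF l] by blast
qed

end
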